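(* Let $q\ge 2$ be an integer and let $f\colon \mathbb{N}_0\to\mathbb{U}$ be a $q$-multiplicative sequence of Gelfond type, i.e. there exists $c>0$ such that $$\sup_{\alpha\in\mathbb{R}}\Big|\frac1N\sum_{n=0}^{N-1} f(n)e(n\alpha)\Big|\ll N^{-c}\qquad (N\ge 1).$$ Then for every integer $d\ge 1$ there exists $c_d>0$ such that $$\sup_{p\in\mathbb{R}[x],\ \deg p\le d}\Big|\frac1N\sum_{n=0}^{N-1} f(n)e(p(n))\Big|\ll N^{-c_d}\qquad (N\ge 1).$$
   Context: $\mathbb{N}_0=\{0,1,2,\dots\}$, $\mathbb{U}=\{z\in\mathbb{C}:|z|=1\}$, $e(t)=e^{2\pi i t}$. A sequence $f\colon\mathbb{N}_0\to\mathbb{U}$ is $q$-multiplicative if for all integers $t,m,n\ge 0$ with $m<q^t$ and $q^t\mid n$ one has $f(m+n)=f(m)f(n)$. The notation $X\ll Y$ means $|X|\le CY$ for some constant $C$ independent of $N$ (it may depend on $f$, $q$, $d$). *)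

theory Defs
  imports "HOL-Analysis.Analysis" "HOL-Computational_Algebra.Polynomial"
begin

definition e :: "real \<Rightarrow> complex" where
  "e t = exp (2 * of_real pi * \<i> * of_real t)"

definition q_multiplicative :: "nat \<Rightarrow> (nat \<Rightarrow> complex) \<Rightarrow> bool" where
  "q_multiplicative q f \<longleftrightarrow>
     (\<forall>t m n. m < q ^ t \<and> q ^ t dvd n \<longrightarrow> f (m + n) = f m * f n)"

definition unimodular_seq :: "(nat \<Rightarrow> complex) \<Rightarrow> bool" where
  "unimodular_seq f \<longleftrightarrow> (\<forall>n. norm (f n) = 1)"

definition gelfond_type :: "(nat \<Rightarrow> complex) \<Rightarrow> bool" where
  "gelfond_type f \<longleftrightarrow> (\<exists>c>0. \<exists>C. \<forall>N\<ge>1. \<forall>\<alpha>::real.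
     norm ((1 / of_nat N) * (\<Sum>n<N. f n * e (real n * \<alpha>))) \<le> C * real N powr (- c))"

end

theory Submission
  imports Defs
begin

text \<open>
  The proof is by induction on the degree \<open>d\<close>, at lengths \<open>N = q\<^sup>L\<close>. Let \<open>a\<close> be the leading
  coefficient of \<open>p\<close> and \<open>H\<close> a small power of \<open>N\<close>.

  If no \<open>b \<le> H\<^bsup>O(1)\<^esup>\<close> brings \<open>b a\<close> very close to an integer, apply van der Corput's inequality with
  shifts \<open>h < H\<close>. The correlation \<open>f (n + h) * cnj (f n)\<close> is periodic modulo \<open>H\<^sup>2\<close> except for
  the few \<open>n\<close> where a carry propagates, so on residue classes only a Weyl sum of degree \<open>d - 1\<close> remains;
  further differencing with shifts below \<open>H\<close> reduces this to geometric sums.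

  Otherwise \<open>a\<close> is close to a rational number with small denominator \<open>b\<close>. Cut into blocks of length
  \<open>q\<^sup>t\<close> with \<open>q\<^sup>t\<close> a power of \<open>N\<close> so small that the error in this approximation is negligible on each
  block. The top term is then \<open>b\<close>-periodic, hence a combination of additive characters,
  which are absorbed into the linear term, and the case of degree \<open>d - 1\<close> applies.
\<close>

subsection \<open>Exponential sums\<close>

lemma e_0 [simp]: "e 0 = 1"
  by (simp add: e_def)

lemma e_add: "e (x + y) = e x * e y"
  by (simp add: e_def exp_add [symmetric] algebra_simps)

lemma norm_e [simp]: "norm (e x) = 1"
  using norm_exp_i_times [of "2 * pi * x"] by (simp add: e_def mult_ac)

lemma cnj_e: "cnj (e x) = e (- x)"
  by (simp add: e_def exp_cnj)

lemma e_diff: "e (x - y) = e x * cnj (e y)"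
  by (simp add: cnj_e flip: e_add)

lemma e_of_int [simp]: "e (of_int k) = 1"
  using exp_integer_2pi [of "of_int k"] by (simp add: e_def mult_ac)

lemma e_of_nat [simp]: "e (of_nat k) = 1"
  using e_of_int [of "int k"] by (simp del: e_of_int)

lemma e_of_nat_mult: "e (real n * x) = e x ^ n"
  by (induction n) (simp_all add: e_add algebra_simps)

lemma norm_e_minus_1: "norm (e x - 1) = 2 * \<bar>sin (pi * x)\<bar>"
  using dist_exp_i_1 [of "2 * pi * x"] by (simp add: e_def dist_norm mult_ac)

lemma norm_e_minus_1_le: "norm (e x - 1) \<le> 2 * pi * \<bar>x\<bar>"
  using abs_sin_x_le_abs_x [of "pi * x"] by (simp add: norm_e_minus_1 abs_mult)

text \<open>With \<open>u\<close> equal to \<open>pi\<close> times the distance from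
  \<open>x\<close> to the nearest integer, \<open>norm (e x - 1)\<close> is \<open>2 sin u\<close>.
  The cubic Taylor bound gives \<open>2 sin u >= u\<close> on \<open>[0, 8/5]\<close>, which
  contains \<open>pi/2\<close>.\<close>

lemma int_near_if_e_near_1:
  obtains k :: int where "\<bar>x - of_int k\<bar> \<le> norm (e x - 1)"
proof -
  define y where "y = x - of_int (round x)"
  have y: "\<bar>y\<bar> \<le> 1/2"
    using of_int_round_abs_le [of x] by (simp add: y_def abs_minus_commute)
  have "e x = e (of_int (round x) + y)"
    by (simp add: y_def)
  then have ey: "e x = e y"
    by (simp only: e_add) simp
  define u where "u = pi * \<bar>y\<bar>"
  have u: "0 \<le> u" "u \<le> 8/5"
    using mult_mono [of pi "16/5" "\<bar>y\<bar>" "1/2"] pi_approx y by (auto simp: u_def)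
  have "\<bar>sin u - (\<Sum>m<3. sin_coeff m * u ^ m)\<bar> \<le> inverse (fact 3) * \<bar>u\<bar> ^ 3"
    by (rule Maclaurin_sin_bound)
  then have "\<bar>sin u - u\<bar> \<le> u ^ 3 / 6"
    using u by (simp add: numeral_3_eq_3 sin_coeff_def fact_numeral)
  then have "sin u \<ge> u - u ^ 3 / 6"
    unfolding abs_le_iff by linarith
  moreover have "u ^ 3 \<le> u * (8/5)^2"
    using mult_left_mono [OF power_mono [OF u(2,1), of 2] u(1)]
    by (simp add: power2_eq_square power3_eq_cube)
  ultimately have "2 * sin u \<ge> u"
    using u by (simp add: power2_eq_square)
  moreover have "\<bar>sin (pi * y)\<bar> = \<bar>sin u\<bar>"
    by (cases "y \<ge> 0") (simp_all add: u_def)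
  moreover have "u \<ge> \<bar>y\<bar>"
    using mult_right_mono [of 1 pi "\<bar>y\<bar>"] pi_ge_two by (simp add: u_def)
  ultimately have "norm (e y - 1) \<ge> \<bar>y\<bar>"
    by (simp add: norm_e_minus_1)
  then show thesis
    using that [of "round x"] ey by (simp add: y_def)
qed

text \<open>Keeping the factor \<open>norm (e x - 1)\<close> on the left avoids excluding integer
  \<open>x\<close>.\<close>

lemma norm_geometric_e_le:
  "norm (\<Sum>n<N. e (real n * x)) * norm (e x - 1) \<le> 2"
proof -
  have "(e x - 1) * (\<Sum>n<N. e (real n * x)) = e x ^ N - 1"
    by (simp add: e_of_nat_mult power_diff_1_eq)
  then have "norm (\<Sum>n<N. e (real n * x)) * norm (e x - 1) = norm (e x ^ N - 1)"
    by (metis mult.commute norm_mult)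
  also have "\<dots> \<le> 1 + 1"
    using norm_triangle_ineq4 [of "e x ^ N" 1] by (simp add: norm_power)
  finally show ?thesis by simp
qed

section \<open>Van der Corput's inequality\<close>

lemma norm_sum_shift_diff_le:
  fixes b :: "nat \<Rightarrow> 'a::real_normed_vector"
  assumes "\<And>n. norm (b n) \<le> 1"
  shows "norm ((\<Sum>n<N. b (n + h)) - (\<Sum>n<N. b n)) \<le> 2 * real h"
proof (induction h)
  case (Suc h)
  have "(\<Sum>n<N. b (n + Suc h)) - (\<Sum>n<N. b (n + h)) = b (N + h) - b h"
    using sum_lessThan_telescope [of "\<lambda>n. b (n + h)" N] by (simp add: sum_subtractf)
  then have "norm ((\<Sum>n<N. b (n + Suc h)) - (\<Sum>n<N. b (n + h))) \<le> 2"
    using norm_triangle_ineq4 [of "b (N + h)" "b h"] assms [of h] assms [of "N + h"] by simp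
  with Suc show ?case
    using norm_triangle_ineq [of "(\<Sum>n<N. b (n + Suc h)) - (\<Sum>n<N. b (n + h))"
        "(\<Sum>n<N. b (n + h)) - (\<Sum>n<N. b n)"] by simp
qed simp

text \<open>Average over \<open>H\<close> shifts, apply Cauchy-Schwarz and expand the square: the
  diagonal yields \<open>1 / H\<close>, the other pairs yield \<open>\<tau>\<close>. The condition
  \<open>H^2 <= N\<close> absorbs the boundary errors of shifting.\<close>

lemma van_der_Corput:
  fixes a :: "nat \<Rightarrow> complex"
  assumes a: "\<And>n. norm (a n) \<le> 1"
    and H: "H \<ge> 1" "H\<^sup>2 \<le> N" and \<tau>: "\<tau> \<ge> 0"
    and corr: "\<And>h. 1 \<le> h \<Longrightarrow> h < H \<Longrightarrow> norm (\<Sum>n<N. a (n + h) * cnj (a n)) \<le> \<tau> * real N"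
  shows "(norm (\<Sum>n<N. a n))\<^sup>2 \<le> (real N)\<^sup>2 * (8 / real H + 2 * \<tau>)"
proof -
  define S where "S = norm (\<Sum>n<N. a n)"
  define X where "X n = (\<Sum>h<H. a (n + h))" for n
  define E where "E = \<tau> * real N + 2 * real H"
  \<comment> \<open>Shifting by \<open>j\<close> turns the pair \<open>(i, j)\<close> into the lag
    \<open>i - j\<close>, at a cost of at most \<open>2 j\<close> from the ends of the
    range.\<close>
  have lag: "norm (\<Sum>n<N. a (n + i) * cnj (a (n + j))) \<le> E"
    if "j < i" "i < H" for i j
  proof -
    define b where "b n = a (n + (i - j)) * cnj (a n)" for n
    have "norm (b n) \<le> 1" for n
      using mult_mono [OF a a] by (simp add: b_def norm_mult)
    then have "norm ((\<Sum>n<N. b (n + j)) - (\<Sum>n<N. b n)) \<le> 2 * real j"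
      by (rule norm_sum_shift_diff_le)
    moreover have "(\<Sum>n<N. b (n + j)) = (\<Sum>n<N. a (n + i) * cnj (a (n + j)))"
      using that by (simp add: b_def algebra_simps)
    moreover have "norm (\<Sum>n<N. b n) \<le> \<tau> * real N"
      unfolding b_def using that by (intro corr) auto
    ultimately show ?thesis
      using norm_triangle_sub [of "\<Sum>n<N. b (n + j)" "\<Sum>n<N. b n"] that by (simp add: E_def)
  qed
  have pair: "norm (\<Sum>n<N. a (n + i) * cnj (a (n + j))) \<le> (if i = j then real N else 0) + E"
    if "i < H" "j < H" for i j
  proof -
    consider "i = j" | "j < i" | "i < j" by linarith
    then show ?thesis
    proof cases
      case 1
      have "norm (\<Sum>n<N. a (n + i) * cnj (a (n + j))) \<le> (\<Sum>n<N. 1)"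
        using mult_mono [OF a a] by (intro sum_norm_le) (simp add: norm_mult)
      moreover have "E \<ge> 0" using \<tau> by (simp add: E_def)
      ultimately show ?thesis using 1 by simp
    next
      case 2
      then show ?thesis using lag that by simp
    next
      case 3
      have "(\<Sum>n<N. a (n + i) * cnj (a (n + j))) = cnj (\<Sum>n<N. a (n + j) * cnj (a (n + i)))"
        by (simp add: mult.commute)
      then have "norm (\<Sum>n<N. a (n + i) * cnj (a (n + j))) = norm (\<Sum>n<N. a (n + j) * cnj (a (n + i)))"
        by (simp only: complex_mod_cnj)
      then show ?thesis using lag [OF 3] 3 that by simp
    qed
  qed
  have "of_real (\<Sum>n<N. (norm (X n))\<^sup>2) = (\<Sum>n<N. X n * cnj (X n))"
    by (simp only: of_real_sum complex_norm_square)
  also have "\<dots> = (\<Sum>n<N. \<Sum>i<H. \<Sum>j<H. a (n + i) * cnj (a (n + j)))"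
    by (simp add: X_def cnj_sum sum_product)
  also have "\<dots> = (\<Sum>i<H. \<Sum>n<N. \<Sum>j<H. a (n + i) * cnj (a (n + j)))"
    by (rule sum.swap)
  also have "\<dots> = (\<Sum>i<H. \<Sum>j<H. \<Sum>n<N. a (n + i) * cnj (a (n + j)))"
    by (intro sum.cong refl sum.swap)
  finally have "norm (complex_of_real (\<Sum>n<N. (norm (X n))\<^sup>2)) \<le>
      (\<Sum>i<H. \<Sum>j<H. (if i = j then real N else 0) + E)"
    by (simp only:) (intro sum_norm_le pair; simp)
  then have sq: "(\<Sum>n<N. (norm (X n))\<^sup>2) \<le> real H * real N + (real H)\<^sup>2 * E"
    by (simp only: norm_of_real sum.distrib)
       (simp add: sum.delta power2_eq_square algebra_simps)
  have "(\<Sum>n<N. norm (X n))\<^sup>2 \<le> (\<Sum>n<N. (norm (X n))\<^sup>2) * (\<Sum>n<N. 1\<^sup>2)"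
    using Cauchy_Schwarz_ineq_sum [of "\<lambda>n. norm (X n)" "\<lambda>_. 1" "{..<N}"] by simp
  also have "\<dots> \<le> (real H * real N + (real H)\<^sup>2 * E) * real N"
    using sq by (simp add: mult_right_mono)
  finally have cs: "(\<Sum>n<N. norm (X n))\<^sup>2 \<le> (real H * real N + (real H)\<^sup>2 * E) * real N" .
  have "norm (\<Sum>h<H. (\<Sum>n<N. a (n + h)) - (\<Sum>n<N. a n)) \<le> (\<Sum>h<H. 2 * real h)"
    by (intro sum_norm_le norm_sum_shift_diff_le a)
  also have "\<dots> = real H * (real H - 1)"
    by (induction H) (auto simp: algebra_simps)
  also have "\<dots> \<le> (real H)\<^sup>2"
    by (simp add: power2_eq_square algebra_simps)
  also have "(\<Sum>h<H. (\<Sum>n<N. a (n + h)) - (\<Sum>n<N. a n)) = (\<Sum>n<N. X n) - of_nat H * (\<Sum>n<N. a n)"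
    by (simp add: sum_subtractf X_def sum.swap [of _ "{..<N}"])
  finally have "norm (of_nat H * (\<Sum>n<N. a n)) \<le> norm (\<Sum>n<N. X n) + (real H)\<^sup>2"
    using norm_triangle_sub [of "of_nat H * (\<Sum>n<N. a n)" "\<Sum>n<N. X n"]
    by (simp add: norm_minus_commute)
  then have HS: "real H * S \<le> (\<Sum>n<N. norm (X n)) + (real H)\<^sup>2"
    using norm_sum [of X "{..<N}"] by (simp add: norm_mult S_def)
  have HN: "(real H)\<^sup>2 \<le> real N"
    using H(2) of_nat_mono by fastforce
  have "(real H * S)\<^sup>2 \<le> ((\<Sum>n<N. norm (X n)) + (real H)\<^sup>2)\<^sup>2"
    using HS by (intro power_mono) (auto simp: S_def)
  also have "\<dots> \<le> 2 * (\<Sum>n<N. norm (X n))\<^sup>2 + 2 * ((real H)\<^sup>2)\<^sup>2"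
    using sum_squares_bound [of "\<Sum>n<N. norm (X n)" "(real H)\<^sup>2"] by (simp add: power2_sum)
  also have "\<dots> \<le> 2 * ((real H * real N + (real H)\<^sup>2 * E) * real N) + 2 * ((real H)\<^sup>2)\<^sup>2"
    using cs by simp
  also have "\<dots> = (real H)\<^sup>2 *
      (2 * (real N)\<^sup>2 / real H + 2 * \<tau> * (real N)\<^sup>2 + 4 * real H * real N + 2 * (real H)\<^sup>2)"
    using H(1) by (simp add: E_def field_simps power2_eq_square)
  finally have "(real H)\<^sup>2 * S\<^sup>2 \<le> (real H)\<^sup>2 *
      (2 * (real N)\<^sup>2 / real H + 2 * \<tau> * (real N)\<^sup>2 + 4 * real H * real N + 2 * (real H)\<^sup>2)"
    by (simp only: power_mult_distrib)
  then have S2: "S\<^sup>2 \<le> 2 * (real N)\<^sup>2 / real H + 2 * \<tau> * (real N)\<^sup>2 + 4 * real H * real N + 2 * (real H)\<^sup>2"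
    using H(1) by simp
  \<comment> \<open>The boundary part \<open>4 H N + 2 H^2\<close> is at most
    \<open>6 N^2 / H\<close>; with the diagonal \<open>2 N^2 / H\<close> this gives the constant
    8.\<close>
  have HN': "real H * real N \<le> (real N)\<^sup>2 / real H"
    using mult_right_mono [OF HN, of "real N"] H(1)
    by (simp add: field_simps power2_eq_square)
  have "real H \<le> real N"
    using H by (metis of_nat_mono power2_nat_le_imp_le)
  then have "(real H)\<^sup>2 \<le> real H * real N"
    by (simp add: power2_eq_square mult_left_mono)
  with S2 HN' have "S\<^sup>2 \<le> 8 * ((real N)\<^sup>2 / real H) + 2 * \<tau> * (real N)\<^sup>2"
    by linarith
  then show ?thesis
    by (simp add: S_def algebra_simps)
qed

subsection \<open>Weyl sums\<close>

text \<open>The \<open>k\<close>-fold difference of \<open>\<phi>\<close> with steps \<open>h\<^sub>1, \<dots>, h\<^sub>k\<close> is \<open>\<alpha> h\<^sub>1 \<cdots> h\<^sub>k\<close>;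
  for a polynomial of degree at most \<open>k\<close>, the number \<open>\<alpha>\<close> is \<open>k!\<close> times its coefficient of \<open>x\<^sup>k\<close>.\<close>

primrec polyphase :: "nat \<Rightarrow> real \<Rightarrow> (nat \<Rightarrow> real) \<Rightarrow> bool" where
  "polyphase 0 \<alpha> \<phi> \<longleftrightarrow> (\<forall>n. \<phi> n = \<alpha>)"
| "polyphase (Suc k) \<alpha> \<phi> \<longleftrightarrow> (\<forall>h. polyphase k (real h * \<alpha>) (\<lambda>n. \<phi> (n + h) - \<phi> n))"

text \<open>A step \<open>h\<close> along the progression is a step \<open>Q h\<close> of
  \<open>\<phi>\<close>, so each of the \<open>k\<close> differencings contributes one factor
  \<open>Q\<close>.\<close>

lemma polyphase_affine:
  "polyphase k \<alpha> \<phi> \<Longrightarrow> polyphase k (real Q ^ k * \<alpha>) (\<lambda>n. \<phi> (Q * n + r))"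
proof (induction k arbitrary: \<alpha> \<phi>)
  case (Suc k)
  have "polyphase k (real h * (real Q ^ Suc k * \<alpha>)) (\<lambda>n. \<phi> (Q * (n + h) + r) - \<phi> (Q * n + r))" for h
  proof -
    have "polyphase k (real (Q * h) * \<alpha>) (\<lambda>n. \<phi> (n + Q * h) - \<phi> n)"
      using Suc.prems unfolding polyphase.simps by blast
    from Suc.IH [OF this] show ?thesis
      by (simp add: algebra_simps)
  qed
  then show ?case by simp
qed simp

lemma polyphase_sum:
  assumes "\<And>i. i \<in> A \<Longrightarrow> polyphase k (\<alpha> i) (\<phi> i)"
  shows "polyphase k (\<Sum>i\<in>A. c i * \<alpha> i) (\<lambda>n. \<Sum>i\<in>A. c i * \<phi> i n)"
  using assms
proof (induction k arbitrary: \<alpha> \<phi>)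
  case (Suc k)
  have "polyphase k (\<Sum>i\<in>A. c i * (real h * \<alpha> i)) (\<lambda>n. \<Sum>i\<in>A. c i * (\<phi> i (n + h) - \<phi> i n))" for h
    using Suc.prems by (intro Suc.IH) auto
  then show ?case
    by (simp add: sum_distrib_left sum_subtractf algebra_simps)
qed simp

text \<open>By the binomial theorem a first difference of \<open>n^j\<close> combines the powers
  \<open>n^i\<close> with \<open>i < j\<close>. Exponents below \<open>k\<close> are included, with
  parameter 0, so that the induction hypothesis covers all of these.\<close>

lemma polyphase_power:
  "j \<le> k \<Longrightarrow> polyphase k (if j = k then fact k else 0) (\<lambda>n. real n ^ j)"
proof (induction k arbitrary: j)
  case (Suc k)
  have "polyphase k (real h * (if j = Suc k then fact (Suc k) else 0))
          (\<lambda>n. real (n + h) ^ j - real n ^ j)" for h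
  proof -
    let ?c = "\<lambda>i. real (j choose i) * real h ^ (j - i)"
    have "polyphase k (\<Sum>i<j. ?c i * (if i = k then fact k else 0)) (\<lambda>n. \<Sum>i<j. ?c i * real n ^ i)"
      using Suc.prems by (intro polyphase_sum Suc.IH) auto
    moreover have "(\<Sum>i<j. ?c i * (if i = k then fact k else 0)) =
        real h * (if j = Suc k then fact (Suc k) else 0)"
      using Suc.prems by (auto simp: if_distrib [of "\<lambda>x. _ * x"] cong: if_cong)
    moreover have "(\<Sum>i<j. ?c i * real n ^ i) = real (n + h) ^ j - real n ^ j" for n
      using binomial_ring [of "real n" "real h" j]
      by (simp add: lessThan_Suc_atMost [symmetric] mult_ac)
    ultimately show ?thesis by simp
  qed
  then show ?case by simp
qed simp

lemma polyphase_poly: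
  assumes "degree p \<le> k"
  shows "polyphase k (fact k * coeff p k) (\<lambda>n. poly p (real n))"
proof -
  have "polyphase k (\<Sum>i\<le>k. coeff p i * (if i = k then fact k else 0))
          (\<lambda>n. \<Sum>i\<le>k. coeff p i * real n ^ i)"
    by (intro polyphase_sum polyphase_power) auto
  moreover have "(\<Sum>i\<le>k. coeff p i * x ^ i) = poly p x" for x
    unfolding poly_altdef using assms
    by (intro sum.mono_neutral_right) (auto simp: coeff_eq_0)
  ultimately show ?thesis
    by (simp add: if_distrib [of "\<lambda>x. _ * x"] mult.commute cong: if_cong)
qed

text \<open>Each van der Corput step replaces \<open>\<alpha>\<close> by \<open>h \<alpha>\<close>
  with \<open>h < H\<close> and halves the exponent of \<open>H\<close>. After \<open>k\<close>
  steps the phase is linear with slope \<open>b \<alpha>\<close>, \<open>b <= H^k\<close>, and the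
  hypothesis bounds the geometric sum by \<open>N / H\<close>.\<close>

lemma Weyl_bound:
  assumes "polyphase (Suc k) \<alpha> \<phi>" and H: "1 \<le> H" "H\<^sup>2 \<le> N"
    and "\<And>b. 1 \<le> b \<Longrightarrow> b \<le> H ^ k \<Longrightarrow> norm (e (real b * \<alpha>) - 1) \<ge> 2 * real H / real N"
  shows "norm (\<Sum>n<N. e (\<phi> n)) \<le> 4 * real N * real H powr (- (1 / 2 ^ k))"
  using assms(1,4)
proof (induction k arbitrary: \<alpha> \<phi>)
  case 0
  have N: "N \<ge> 1" using H by (metis le_trans one_le_power)
  have \<phi>: "\<phi> n = \<phi> 0 + real n * \<alpha>" for n
  proof -
    have "\<phi> (0 + n) - \<phi> 0 = real n * \<alpha>"
      using "0.prems"(1) unfolding polyphase.simps by blast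
    then show ?thesis by simp
  qed
  have "norm (\<Sum>n<N. e (\<phi> n)) = norm (e (\<phi> 0) * (\<Sum>n<N. e (real n * \<alpha>)))"
    by (subst \<phi>) (simp add: e_add sum_distrib_left)
  then have "norm (\<Sum>n<N. e (\<phi> n)) = norm (\<Sum>n<N. e (real n * \<alpha>))"
    by (simp add: norm_mult)
  moreover have "norm (\<Sum>n<N. e (real n * \<alpha>)) * (2 * real H / real N) \<le> 2"
    using norm_geometric_e_le [of \<alpha> N] "0.prems"(2) [of 1]
      mult_left_mono [of "2 * real H / real N" "norm (e \<alpha> - 1)" "norm (\<Sum>n<N. e (real n * \<alpha>))"]
    by simp
  ultimately have "norm (\<Sum>n<N. e (\<phi> n)) \<le> real N / real H"
    using N H by (simp add: field_simps)
  also have "\<dots> \<le> 4 * real N / real H"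
    by (simp add: divide_right_mono)
  finally show ?case using H by (simp add: powr_minus_divide)
next
  case (Suc k)
  let ?c = "1 / 2 ^ k :: real"
  define S where "S = norm (\<Sum>n<N. e (\<phi> n))"
  have corr: "norm (\<Sum>n<N. e (\<phi> (n + h)) * cnj (e (\<phi> n))) \<le> 4 * real H powr (- ?c) * real N"
    if h: "1 \<le> h" "h < H" for h
  proof -
    have "norm (\<Sum>n<N. e (\<phi> (n + h) - \<phi> n)) \<le> 4 * real N * real H powr (- ?c)"
    proof (rule Suc.IH)
      show "polyphase (Suc k) (real h * \<alpha>) (\<lambda>n. \<phi> (n + h) - \<phi> n)"
        using Suc.prems(1) by (subst (asm) polyphase.simps) blast
      fix b :: nat assume b: "1 \<le> b" "b \<le> H ^ k"
      have "b * h \<le> H ^ Suc k"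
        using mult_le_mono [OF b(2), of h H] h by (simp add: mult.commute)
      then show "norm (e (real b * (real h * \<alpha>)) - 1) \<ge> 2 * real H / real N"
        using Suc.prems(2) [of "b * h"] b h by (simp add: mult.assoc)
    qed
    then show ?thesis by (simp add: e_diff mult_ac)
  qed
  have "S\<^sup>2 \<le> (real N)\<^sup>2 * (8 / real H + 2 * (4 * real H powr (- ?c)))"
    unfolding S_def using H corr by (intro van_der_Corput) auto
  also have "1 / real H \<le> real H powr (- ?c)"
    using H powr_mono [of "- 1" "- ?c" "real H"] by (simp add: powr_minus_divide)
  \<comment> \<open>The constant 4 reproduces itself, since \<open>8 + 2 * 4 = 4^2\<close>.\<close>
  then have "(real N)\<^sup>2 * (8 / real H + 2 * (4 * real H powr (- ?c))) \<le>
      (real N)\<^sup>2 * (16 * real H powr (- ?c))"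
    by (intro mult_left_mono) auto
  also have "\<dots> = (4 * real N * real H powr (- (?c / 2)))\<^sup>2"
    by (simp add: power_mult_distrib power2_eq_square flip: powr_add)
  finally have "S \<le> 4 * real N * real H powr (- (?c / 2))"
    by (rule power2_le_imp_le) auto
  then show ?case by (simp add: S_def mult.commute)
qed

subsection \<open>Periodic twists\<close>

lemma sum_lessThan_add:
  fixes F :: "nat \<Rightarrow> 'a::comm_monoid_add"
  shows "(\<Sum>n<a + b. F n) = (\<Sum>n<a. F n) + (\<Sum>r<b. F (a + r))"
  by (induction b) (simp_all add: add.assoc)

lemma sum_lessThan_mult:
  fixes F :: "nat \<Rightarrow> 'a::comm_monoid_add"
  shows "(\<Sum>n<a * b. F n) = (\<Sum>m<b. \<Sum>r<a. F (a * m + r))"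
proof (induction b)
  case (Suc b)
  have "(\<Sum>n<a * Suc b. F n) = (\<Sum>n<a * b + a. F n)"
    by (simp add: add.commute)
  then show ?case
    using Suc by (simp add: sum_lessThan_add)
qed simp

text \<open>Orthogonality of characters: \<open>e y\<close> is a \<open>B\<close>-th root of unity,
  so its geometric sum vanishes unless \<open>e y = 1\<close>.\<close>

lemma sum_additive_characters:
  fixes m r B :: nat
  assumes "r < B"
  shows "(\<Sum>j<B. e (real j * ((real m - real r) / real B))) = (if r = m mod B then of_nat B else 0)"
proof -
  define y where "y = (real m - real r) / real B"
  have By: "real B * y = of_int (int m - int r)"
    using assms by (simp add: y_def)
  have e_y_pow: "e y ^ B = 1"
    unfolding e_of_nat_mult [symmetric] By by (rule e_of_int)
  have "e y = 1 \<longleftrightarrow> r = m mod B"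
  proof
    assume "e y = 1"
    moreover obtain k :: int where "\<bar>y - of_int k\<bar> \<le> norm (e y - 1)"
      by (rule int_near_if_e_near_1)
    ultimately have "y = of_int k" by simp
    then have "real_of_int (int m - int r) = of_int (int B * k)"
      using By by simp
    then have "int m = int r + int B * k"
      by linarith
    then have "int m mod int B = int r"
      using assms by simp
    then show "r = m mod B"
      by (metis nat_int zmod_int)
  next
    assume "r = m mod B"
    then have "real m = real B * real (m div B) + real r"
      by (metis mult_div_mod_eq of_nat_add of_nat_mult)
    then have "y = real (m div B)"
      using assms by (simp add: y_def)
    then show "e y = 1" by simp
  qed
  then show ?thesis
    unfolding y_def [symmetric] e_of_nat_mult
    using e_y_pow by (auto simp: geometric_sum)
qed

text \<open>Expanding \<open>G\<close> in additive characters modulo \<open>B\<close> leaves linear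
  phases. Bounding the \<open>B^2\<close> terms of the expansion of \<open>B G\<close> separately
  costs the factor \<open>B\<close>.\<close>

lemma norm_sum_periodic_twist_le:
  fixes a G :: "nat \<Rightarrow> complex"
  assumes B: "B \<ge> 1" and G: "\<And>m. G m = G (m mod B)" "\<And>m. norm (G m) \<le> 1"
    and a: "\<And>x. norm (\<Sum>m<N. a m * e (real m * x)) \<le> T"
  shows "norm (\<Sum>m<N. a m * G m) \<le> real B * T"
proof -
  have G_eq: "of_nat B * G m = (\<Sum>r<B. \<Sum>j<B. G r * e (real j * ((real m - real r) / real B)))" for m
  proof -
    have "(\<Sum>r<B. \<Sum>j<B. G r * e (real j * ((real m - real r) / real B))) =
        (\<Sum>r<B. if r = m mod B then of_nat B * G r else 0)"
      by (intro sum.cong refl) (simp only: sum_additive_characters lessThan_iff flip: sum_distrib_left, simp)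
    also have "\<dots> = of_nat B * G (m mod B)"
      using B by (subst sum.delta) auto
    finally show ?thesis using G(1) by metis
  qed
  have "of_nat B * (\<Sum>m<N. a m * G m) = (\<Sum>m<N. a m * (of_nat B * G m))"
    by (simp add: sum_distrib_left mult_ac)
  also have "\<dots> = (\<Sum>m<N. \<Sum>r<B. \<Sum>j<B. a m * (G r * e (real j * ((real m - real r) / real B))))"
    unfolding G_eq by (simp add: sum_distrib_left)
  also have "\<dots> = (\<Sum>r<B. \<Sum>m<N. \<Sum>j<B. a m * (G r * e (real j * ((real m - real r) / real B))))"
    by (rule sum.swap)
  also have "\<dots> = (\<Sum>r<B. \<Sum>j<B. \<Sum>m<N. a m * (G r * e (real j * ((real m - real r) / real B))))"
    by (intro sum.cong refl sum.swap)
  also have "norm \<dots> \<le> (\<Sum>r<B. \<Sum>j<B. T)"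
  proof (intro sum_norm_le)
    fix r j :: nat
    define x where "x = real j / real B"
    have "(\<Sum>m<N. a m * (G r * e (real j * ((real m - real r) / real B)))) =
        (\<Sum>m<N. G r * cnj (e (real r * x)) * (a m * e (real m * x)))"
      by (simp add: x_def diff_divide_distrib e_diff algebra_simps)
    also have "\<dots> = G r * cnj (e (real r * x)) * (\<Sum>m<N. a m * e (real m * x))"
      by (simp only: sum_distrib_left)
    also have "norm \<dots> \<le> 1 * T"
      unfolding norm_mult using G(2) [of r] a [of x] by (intro mult_mono) auto
    finally show "norm (\<Sum>m<N. a m * (G r * e (real j * ((real m - real r) / real B)))) \<le> T"
      by simp
  qed
  finally show ?thesis
    using B by (simp add: norm_mult)
qed

text \<open>Restricting to a block translates the polynomial; the top coefficient, the only one
  approximated by rationals, survives.\<close>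

lemma coeff_pcompose_shift:
  fixes p :: "'a::idom poly"
  assumes "degree p \<le> d"
  shows "coeff (pcompose p [:c, 1:]) d = coeff p d"
proof (cases "degree p = d")
  case True
  then show ?thesis
    using lead_coeff_comp [of "[:c, 1:]" p] by (simp add: degree_pcompose)
next
  case False
  then show ?thesis
    using assms by (simp add: coeff_eq_0 degree_pcompose)
qed

text \<open>Turns a saving in a small scale \<open>Q\<close> into one in \<open>x\<close>: raise
  \<open>x <= (a Q)^J\<close> to the power \<open>\<kappa> / J\<close>. The factor \<open>a\<close>
  pays for rounding \<open>Q\<close> down to a power of \<open>q\<close>.\<close>

lemma powr_minus_le_powr_minus:
  fixes a Q x \<kappa> :: real
  assumes "1 \<le> a" "1 \<le> Q" "1 \<le> x" "0 \<le> \<kappa>" "1 \<le> J" "x \<le> (a * Q) ^ J"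
  shows "Q powr (- \<kappa>) \<le> a powr \<kappa> * x powr (- (\<kappa> / real J))"
proof -
  have "x powr (\<kappa> / real J) \<le> ((a * Q) ^ J) powr (\<kappa> / real J)"
    using assms by (intro powr_mono2) auto
  also have "\<dots> = a powr \<kappa> * Q powr \<kappa>"
    using assms by (simp add: powr_powr powr_mult flip: powr_realpow)
  finally show ?thesis
    using assms by (simp add: powr_minus field_simps)
qed

subsection \<open>Multiplicative sequences\<close>

locale unimodular_q_multiplicative =
  fixes q :: nat and f :: "nat \<Rightarrow> complex"
  assumes q: "q \<ge> 2" and norm_f [simp]: "norm (f n) = 1"
    and f_add: "m < q ^ t \<Longrightarrow> q ^ t dvd n \<Longrightarrow> f (m + n) = f m * f n"
begin

lemma f_block: "m < q ^ t \<Longrightarrow> f (q ^ t * M + m) = f (q ^ t * M) * f m"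
  using f_add [of m t "q ^ t * M"] by (simp add: add.commute mult.commute)

lemma q_power_ge_1: "1 \<le> q ^ n"
  using q by simp

text \<open>If adding \<open>h\<close> to \<open>r\<close> causes no carry beyond the lowest \<open>2s\<close> digits, then
  \<open>f (n + h) * cnj (f n)\<close> is constant for \<open>n\<close> congruent to \<open>r\<close> modulo \<open>q\<^sup>2\<^sup>s\<close>.\<close>

lemma norm_twisted_correlation_le:
  assumes h: "h < q ^ s" and s: "2 * s \<le> L"
    and \<tau>: "\<And>r. norm (\<Sum>m<q ^ (L - 2 * s). e (\<psi> (q ^ (2 * s) * m + r))) \<le> \<tau> * real (q ^ (L - 2 * s))"
  shows "norm (\<Sum>n<q ^ L. f (n + h) * cnj (f n) * e (\<psi> n)) \<le> (\<tau> + 1 / real (q ^ s)) * real (q ^ L)"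
proof -
  \<comment> \<open>The modulus is the square of the shift range, so carries affect a fraction
    \<open>h / W < 1 / q^s\<close> of the classes.\<close>
  define W M where "W = q ^ (2 * s)" and "M = q ^ (L - 2 * s)"
  define F where "F n = f (n + h) * cnj (f n) * e (\<psi> n)" for n
  have WM: "q ^ L = W * M"
    using s by (simp add: W_def M_def flip: power_add)
  have hW: "h < W"
    unfolding W_def using h by (rule less_le_trans) (use q in \<open>auto intro: power_increasing\<close>)
  have \<tau>0: "0 \<le> \<tau> * real M"
    using order_trans [OF norm_ge_zero \<tau> [of 0]] by (simp add: M_def)
  have cls: "norm (\<Sum>m<M. F (W * m + r)) \<le> \<tau> * real M + (if r \<in> {W - h..<W} then real M else 0)"
    if r: "r < W" for r
  proof (cases "r + h < W")
    case True
    have "F (W * m + r) = f (r + h) * cnj (f r) * e (\<psi> (W * m + r))" for m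
    proof -
      have "f (W * m + r + h) = f (W * m) * f (r + h)"
        using f_block [of "r + h" "2 * s" m] True by (simp add: W_def add.assoc)
      moreover have "f (W * m + r) = f (W * m) * f r"
        using f_block [of r "2 * s" m] r by (simp add: W_def)
      moreover have "f (W * m) * cnj (f (W * m)) = 1"
        by (simp flip: complex_norm_square)
      ultimately show ?thesis
        by (simp add: F_def)
    qed
    then have "(\<Sum>m<M. F (W * m + r)) = f (r + h) * cnj (f r) * (\<Sum>m<M. e (\<psi> (W * m + r)))"
      by (simp add: sum_distrib_left)
    then have "norm (\<Sum>m<M. F (W * m + r)) \<le> \<tau> * real M"
      using \<tau> [of r] by (simp add: norm_mult W_def M_def)
    then show ?thesis by simp
  next
    case False
    have "norm (\<Sum>m<M. F (W * m + r)) \<le> (\<Sum>m<M. 1)"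
      by (intro sum_norm_le) (simp add: F_def norm_mult)
    then show ?thesis using False r \<tau>0 by auto
  qed
  have "(\<Sum>n<q ^ L. F n) = (\<Sum>r<W. \<Sum>m<M. F (W * m + r))"
    unfolding WM sum_lessThan_mult by (rule sum.swap)
  also have "norm \<dots> \<le> (\<Sum>r<W. \<tau> * real M + (if r \<in> {W - h..<W} then real M else 0))"
    by (intro sum_norm_le cls) auto
  also have "\<dots> = \<tau> * real (W * M) + (\<Sum>r\<in>{..<W} \<inter> {W - h..<W}. real M)"
    by (simp only: sum.distrib sum.inter_restrict [OF finite_lessThan]) simp
  also have "{..<W} \<inter> {W - h..<W} = {W - h..<W}"
    by auto
  also have "(\<Sum>r\<in>{W - h..<W}. real M) = real h * real M"
    using hW by simp
  also have "\<dots> \<le> real (q ^ s) * real M"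
    using h by (intro mult_right_mono) auto
  also have "\<dots> = 1 / real (q ^ s) * real (W * M)"
    using q by (simp add: W_def field_simps power_mult power2_eq_square flip: power_mult_distrib)
  finally show ?thesis
    by (simp add: F_def WM distrib_right)
qed

section \<open>Minor arcs\<close>

text \<open>Van der Corput with \<open>H = q^s\<close> leaves, on classes modulo \<open>H^2\<close>,
  phases with parameter \<open>(H^2)^(k+1) h \<alpha>\<close>. Weyl's bound takes multiples of this
  up to \<open>H^k\<close>, hence the range \<open>H^(3k+3)\<close>. The classes have length
  \<open>q^L / H^2\<close>, hence the threshold \<open>2 H^3 / q^L\<close>; \<open>4 s <= L\<close>
  makes them at least \<open>H^2\<close> long.\<close>

lemma minor_arc_bound:
  assumes \<phi>: "polyphase (Suc (Suc k)) \<alpha> \<phi>" and s: "4 * s \<le> L"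
    and \<alpha>: "\<And>b. 1 \<le> b \<Longrightarrow> b \<le> q ^ (3 * Suc k * s) \<Longrightarrow>
      norm (e (real b * \<alpha>) - 1) \<ge> 2 * real (q ^ s) ^ 3 / real (q ^ L)"
  shows "norm (\<Sum>n<q ^ L. f n * e (\<phi> n)) \<le> 5 * real (q ^ L) * real (q ^ s) powr (- (1 / 2 ^ Suc k))"
proof -
  define H M where "H = q ^ s" and "M = q ^ (L - 2 * s)"
  let ?\<kappa> = "1 / 2 ^ k :: real"
  have H1: "1 \<le> H"
    using q_power_ge_1 by (simp add: H_def)
  have H2: "H\<^sup>2 = q ^ (2 * s)"
    by (simp add: H_def mult.commute flip: power_mult)
  have HM: "H\<^sup>2 \<le> M" "H\<^sup>2 \<le> q ^ L"
    unfolding H2 M_def using s q by (intro power_increasing; simp)+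
  have LM: "real (q ^ L) = (real H)\<^sup>2 * real M"
    using s by (simp add: H2 M_def flip: power_add of_nat_power of_nat_mult)
  have H_powr: "1 / real H \<le> real H powr (- ?\<kappa>)"
    using H1 powr_mono [of "- 1" "- ?\<kappa>" "real H"] by (simp add: powr_minus_divide)
  have corr: "norm (\<Sum>n<q ^ L. f (n + h) * e (\<phi> (n + h)) * cnj (f n * e (\<phi> n)))
      \<le> (5 * real H powr (- ?\<kappa>)) * real (q ^ L)" if h: "1 \<le> h" "h < H" for h
  proof -
    define \<psi> where "\<psi> n = \<phi> (n + h) - \<phi> n" for n
    have \<psi>: "polyphase (Suc k) (real h * \<alpha>) \<psi>"
      using \<phi> unfolding \<psi>_def by (subst (asm) polyphase.simps) blast
    have "norm (\<Sum>m<M. e (\<psi> (H\<^sup>2 * m + r))) \<le> 4 * real M * real H powr (- ?\<kappa>)" for r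
    proof (rule Weyl_bound [OF polyphase_affine [OF \<psi>] H1 HM(1)])
      fix b :: nat assume b: "1 \<le> b" "b \<le> H ^ k"
      define B where "B = b * (H\<^sup>2 ^ Suc k * h)"
      have "B \<le> H ^ k * (H\<^sup>2 ^ Suc k * H)"
        unfolding B_def using b h by (intro mult_le_mono) auto
      also have "\<dots> = H ^ (k + 2 * Suc k + 1)"
        by (simp only: power_add power_mult power_one_right mult.assoc)
      also have "k + 2 * Suc k + 1 = 3 * Suc k"
        by simp
      also have "H ^ (3 * Suc k) = q ^ (3 * Suc k * s)"
        by (simp only: H_def mult.commute flip: power_mult)
      finally have "norm (e (real B * \<alpha>) - 1) \<ge> 2 * real H ^ 3 / real (q ^ L)"
        using \<alpha> [of B] b h H1 by (simp add: B_def H_def)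
      also have "2 * real H ^ 3 / real (q ^ L) = 2 * real H / real M"
        unfolding LM using H1 by (simp add: power2_eq_square power3_eq_cube)
      finally show "norm (e (real b * (real (H\<^sup>2) ^ Suc k * (real h * \<alpha>))) - 1) \<ge> 2 * real H / real M"
        by (simp add: B_def mult.assoc)
    qed
    then have "norm (\<Sum>m<q ^ (L - 2 * s). e (\<psi> (q ^ (2 * s) * m + r))) \<le>
        4 * real H powr (- ?\<kappa>) * real (q ^ (L - 2 * s))" for r
      by (simp only: H2 M_def mult_ac)
    then have "norm (\<Sum>n<q ^ L. f (n + h) * cnj (f n) * e (\<psi> n)) \<le>
        (4 * real H powr (- ?\<kappa>) + 1 / real H) * real (q ^ L)"
      unfolding H_def using h s by (intro norm_twisted_correlation_le) (auto simp: H_def)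
    also have "\<dots> \<le> (5 * real H powr (- ?\<kappa>)) * real (q ^ L)"
      using H_powr by (intro mult_right_mono) auto
    finally show ?thesis
      by (simp add: \<psi>_def e_diff mult_ac)
  qed
  have "(norm (\<Sum>n<q ^ L. f n * e (\<phi> n)))\<^sup>2 \<le>
      (real (q ^ L))\<^sup>2 * (8 / real H + 2 * (5 * real H powr (- ?\<kappa>)))"
    using H1 HM corr by (intro van_der_Corput) (auto simp: norm_mult)
  \<comment> \<open>The 5 is 4 from Weyl's bound plus 1 from carries;
    \<open>8 + 2 * 5 <= 5^2\<close> lets 5 serve again after the square root.\<close>
  also have "8 / real H + 2 * (5 * real H powr (- ?\<kappa>)) \<le> 25 * real H powr (- ?\<kappa>)"
  proof -
    have "0 \<le> real H powr (- ?\<kappa>)" by (rule powr_ge_zero)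
    with H_powr show ?thesis by linarith
  qed
  then have "(real (q ^ L))\<^sup>2 * (8 / real H + 2 * (5 * real H powr (- ?\<kappa>))) \<le>
      (real (q ^ L))\<^sup>2 * (25 * real H powr (- ?\<kappa>))"
    by (intro mult_left_mono) auto
  also have "\<dots> = (5 * real (q ^ L) * real H powr (- (?\<kappa> / 2)))\<^sup>2"
    by (simp add: power_mult_distrib power2_eq_square flip: powr_add)
  finally have "norm (\<Sum>n<q ^ L. f n * e (\<phi> n)) \<le> 5 * real (q ^ L) * real H powr (- (?\<kappa> / 2))"
    by (rule power2_le_imp_le) auto
  then show ?thesis by (simp add: H_def mult.commute)
qed

section \<open>Block decomposition and major arcs\<close>

text \<open>On each block \<open>f\<close> splits off a unimodular factor and \<open>p\<close>
  becomes a translate, so a bound uniform over polynomials with the same top coefficient bounds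
  every block.\<close>

lemma norm_sum_blocks_le:
  assumes p: "degree p \<le> d"
    and T: "\<And>p'. degree p' \<le> d \<Longrightarrow> coeff p' d = coeff p d \<Longrightarrow>
      norm (\<Sum>m<q ^ t. f m * e (poly p' (real m))) \<le> T"
  shows "norm (\<Sum>n<q ^ t * M. f n * e (poly p (real n))) \<le> real M * T"
proof -
  have "norm (\<Sum>m<q ^ t. f (q ^ t * i + m) * e (poly p (real (q ^ t * i + m)))) \<le> T" for i
  proof -
    define p' where "p' = pcompose p [:real (q ^ t * i), 1:]"
    have "(\<Sum>m<q ^ t. f (q ^ t * i + m) * e (poly p (real (q ^ t * i + m)))) =
        f (q ^ t * i) * (\<Sum>m<q ^ t. f m * e (poly p' (real m)))"
      by (simp add: sum_distrib_left f_block p'_def poly_pcompose mult.assoc)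
    moreover have "norm (\<Sum>m<q ^ t. f m * e (poly p' (real m))) \<le> T"
      using p by (intro T) (simp_all add: p'_def coeff_pcompose_shift degree_pcompose)
    ultimately show ?thesis by (simp add: norm_mult)
  qed
  then have "norm (\<Sum>n<q ^ t * M. f n * e (poly p (real n))) \<le> (\<Sum>i<M. T)"
    unfolding sum_lessThan_mult by (intro sum_norm_le)
  then show ?thesis by simp
qed

text \<open>Lengths \<open>q^L\<close> split exactly into residue classes and blocks; other lengths
  are left to \<open>power_saving_all_lengths\<close>.\<close>

definition power_saving :: "nat \<Rightarrow> real \<Rightarrow> real \<Rightarrow> bool" where
  "power_saving d c C \<longleftrightarrow> (\<forall>L p. degree p \<le> d \<longrightarrow>
     norm (\<Sum>n<q ^ L. f n * e (poly p (real n))) \<le> C * real (q ^ L) * real (q ^ L) powr (- c))"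

lemma power_saving_nonneg:
  assumes "power_saving d c C"
  shows "0 \<le> C"
  using assms [unfolded power_saving_def, rule_format, of 0 0] order_trans [OF norm_ge_zero]
  by fastforce

text \<open>Write the top coefficient as \<open>A / B + \<beta>\<close>. On a block, dropping
  \<open>\<beta>\<close> costs the first term of the bound, and the \<open>B\<close>-periodic factor
  from \<open>A / B\<close> costs the \<open>B\<close> in the second.\<close>

lemma major_arc_bound:
  assumes c: "power_saving k c C" and k: "1 \<le> k" and p: "degree p \<le> Suc k" and B: "1 \<le> B"
    and A: "\<bar>real B * coeff p (Suc k) - of_int A\<bar> \<le> \<rho>" and t: "t \<le> L"
  shows "norm (\<Sum>n<q ^ L. f n * e (poly p (real n))) \<le>
    real (q ^ L) * (2 * pi * \<rho> * real (q ^ t) ^ Suc k + real B * C * real (q ^ t) powr (- c))"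
proof -
  define Q where "Q = q ^ t"
  define T where "T = real Q * (2 * pi * \<rho> * real Q ^ Suc k + real B * C * real Q powr (- c))"
  have block: "norm (\<Sum>m<Q. f m * e (poly p' (real m))) \<le> T"
    if p': "degree p' \<le> Suc k" "coeff p' (Suc k) = coeff p (Suc k)" for p'
  proof -
    define a \<beta> where "a = coeff p (Suc k)" and "\<beta> = (real B * coeff p (Suc k) - of_int A) / real B"
    define r where "r = p' - monom a (Suc k)"
    define G where "G m = e (of_int A * real m ^ Suc k / real B)" for m :: nat
    have "degree r \<le> k"
      using p' by (intro degree_le) (auto simp: r_def a_def coeff_eq_0 Suc_lessI)
    have split: "poly p' x = poly r x + a * x ^ Suc k" for x
      by (simp add: r_def poly_monom)
    have a: "a = of_int A / real B + \<beta>"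
      using B by (simp add: a_def \<beta>_def field_simps)
    have \<beta>: "\<bar>\<beta>\<bar> \<le> \<rho>"
    proof -
      have "\<bar>\<beta>\<bar> \<le> \<rho> / real B"
        using A B by (simp add: \<beta>_def abs_divide divide_right_mono)
      also have "\<dots> \<le> \<rho> / 1"
        using A B by (intro divide_left_mono) auto
      finally show ?thesis by simp
    qed
    have ep: "e (poly p' (real m)) = e (poly r (real m)) * G m * e (\<beta> * real m ^ Suc k)" for m
      proof -
      have "poly p' (real m) = poly r (real m) + of_int A * real m ^ Suc k / real B + \<beta> * real m ^ Suc k"
        by (simp add: split a distrib_right del: power_Suc)
      then show ?thesis by (simp only: G_def e_add)
    qed
    have "norm (\<Sum>m<Q. f m * e (poly p' (real m)) - f m * e (poly r (real m)) * G m) \<le>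
        (\<Sum>m<Q. 2 * pi * \<rho> * real Q ^ Suc k)"
    proof (rule sum_norm_le)
      fix m assume m: "m \<in> {..<Q}"
      have "f m * e (poly p' (real m)) - f m * e (poly r (real m)) * G m =
          f m * e (poly r (real m)) * G m * (e (\<beta> * real m ^ Suc k) - 1)"
        by (simp add: ep algebra_simps)
      then have "norm (f m * e (poly p' (real m)) - f m * e (poly r (real m)) * G m) =
          norm (e (\<beta> * real m ^ Suc k) - 1)"
        by (simp add: norm_mult G_def)
      also have "\<dots> \<le> 2 * pi * (\<bar>\<beta>\<bar> * real m ^ Suc k)"
        using norm_e_minus_1_le [of "\<beta> * real m ^ Suc k"] by (simp only: abs_mult) simp
      also have "\<dots> \<le> 2 * pi * (\<rho> * real Q ^ Suc k)"
        using \<beta> m by (intro mult_left_mono mult_mono power_mono) auto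
      finally show "norm (f m * e (poly p' (real m)) - f m * e (poly r (real m)) * G m) \<le>
          2 * pi * \<rho> * real Q ^ Suc k"
        by (simp add: mult.assoc)
    qed
    then have 1: "norm ((\<Sum>m<Q. f m * e (poly p' (real m))) - (\<Sum>m<Q. f m * e (poly r (real m)) * G m)) \<le>
        real Q * (2 * pi * \<rho> * real Q ^ Suc k)"
      by (simp add: sum_subtractf)
    have 2: "norm (\<Sum>m<Q. f m * e (poly r (real m)) * G m) \<le> real B * (C * real Q * real Q powr (- c))"
    proof (rule norm_sum_periodic_twist_le [OF B])
      fix m
      \<comment> \<open>Congruent numbers have congruent powers modulo \<open>B\<close>, so the two
        phases differ by the integer \<open>A z\<close>.\<close>
      have "int m ^ Suc k mod int B = int (m mod B) ^ Suc k mod int B"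
        by (simp only: of_nat_mod power_mod)
      then have "int B dvd int m ^ Suc k - int (m mod B) ^ Suc k"
        by (simp only: mod_eq_dvd_iff)
      then obtain z where "int m ^ Suc k - int (m mod B) ^ Suc k = int B * z" ..
      then have "int m ^ Suc k = int (m mod B) ^ Suc k + int B * z"
        by linarith
      then have "real m ^ Suc k = real (m mod B) ^ Suc k + real B * of_int z"
        by (metis of_int_add of_int_mult of_int_of_nat_eq of_int_power)
      then have "of_int A * real m ^ Suc k / real B =
          of_int A * real (m mod B) ^ Suc k / real B + of_int (A * z)"
        using B by (simp add: field_simps)
      then show "G m = G (m mod B)"
        by (simp only: G_def e_add e_of_int) simp
    next
      show "norm (G m) \<le> 1" for m by (simp add: G_def)
    next
      fix x
      \<comment> \<open>The character becomes a linear term of the polynomial; \<open>1 <= k\<close>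
        leaves room for it.\<close>
      have "f m * e (poly r (real m)) * e (real m * x) = f m * e (poly (r + [:0, x:]) (real m))" for m
        by (simp add: e_add)
      moreover have "degree (r + [:0, x:]) \<le> k"
        using \<open>degree r \<le> k\<close> k by (intro degree_add_le) auto
      ultimately show "norm (\<Sum>m<Q. f m * e (poly r (real m)) * e (real m * x)) \<le> C * real Q * real Q powr (- c)"
        using c by (simp only: power_saving_def Q_def)
    qed
    show ?thesis
      using 1 2 norm_triangle_sub [of "\<Sum>m<Q. f m * e (poly p' (real m))" "\<Sum>m<Q. f m * e (poly r (real m)) * G m"]
      by (simp add: T_def algebra_simps)
  qed
  have "norm (\<Sum>n<q ^ t * q ^ (L - t). f n * e (poly p (real n))) \<le> real (q ^ (L - t)) * T"
    using p block by (intro norm_sum_blocks_le) (auto simp: Q_def)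
  also have "q ^ t * q ^ (L - t) = q ^ L"
    using t by (simp flip: power_add)
  also have "real (q ^ (L - t)) * T = real (q ^ (L - t)) * real (q ^ t) *
      (2 * pi * \<rho> * real (q ^ t) ^ Suc k + real B * C * real (q ^ t) powr (- c))"
    by (simp add: T_def Q_def mult.assoc)
  also have "real (q ^ (L - t)) * real (q ^ t) = real (q ^ L)"
    using t by (simp flip: power_add)
  finally show ?thesis .
qed


section \<open>Induction on the degree\<close>

text \<open>If the minor arc condition fails for \<open>d!\<close> times the top coefficient, the
  failing \<open>b\<close> makes \<open>b d!\<close> an approximate denominator of that coefficient,
  and the major arc bound applies.\<close>

lemma power_saving_Suc:
  assumes IH: "power_saving (Suc j) c C" and c: "c > 0"
  shows "\<exists>c'>0. \<exists>C'. power_saving (Suc (Suc j)) c' C'"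
proof -
  define d where "d = Suc (Suc j)"
  \<comment> \<open>With \<open>Q = q\<^sup>s\<close> and \<open>s \<approx> L / J\<close>, the block length is \<open>Q\<^sup>K\<close>. The choice of \<open>K\<close> makes the saving
    \<open>Q powr (- K c)\<close> on a block beat the denominator, which is at most \<open>d! Q ^ (3 (j + 1))\<close>; the
    choice of \<open>J\<close> makes blocks so short that the error in approximating the leading coefficient
    is negligible on each of them.\<close>
  define K where "K = nat \<lceil>real (3 * Suc j + 1) / c\<rceil>"
  define J where "J = K * d + 4"
  \<comment> \<open>The minor arc exponent; major arcs save a full factor \<open>Q\<close>, which is
    at least as good since \<open>\<kappa> <= 1\<close>.\<close>
  define \<kappa> where "\<kappa> = (1 / 2 ^ Suc j :: real)"
  define C1 where "C1 = 5 + 4 * pi + fact d * C"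
  have C: "0 \<le> C"
    using IH by (rule power_saving_nonneg)
  have \<kappa>: "0 < \<kappa>" "\<kappa> \<le> 1"
    using one_le_power [of "2 :: real" "Suc j"] by (simp_all add: \<kappa>_def divide_le_eq_1 del: power_Suc)
  have Kc: "real (3 * Suc j + 1) \<le> real K * c"
    using c by (simp add: K_def pos_divide_le_eq [symmetric] del: of_nat_add of_nat_mult)
  have "norm (\<Sum>n<q ^ L. f n * e (poly p (real n))) \<le>
      C1 * real q powr \<kappa> * real (q ^ L) * real (q ^ L) powr (- (\<kappa> / real J))"
    if p: "degree p \<le> d" for L p
  proof -
    define s t where "s = L div J" and "t = K * s"
    define Q where "Q = real (q ^ s)"
    define S where "S = norm (\<Sum>n<q ^ L. f n * e (poly p (real n)))"
    define \<alpha> where "\<alpha> = fact d * coeff p d"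
    have JL: "J * s \<le> L"
      by (simp add: s_def)
    have Q1: "1 \<le> Q"
      using q_power_ge_1 by (simp add: Q_def flip: of_nat_power)
    have QJ: "Q ^ J \<le> real (q ^ L)"
      using JL power_increasing [of "s * J" L "real q"] q
      by (simp add: Q_def mult.commute flip: power_mult)
    have s4: "4 * s \<le> L" and tL: "t \<le> L"
      using JL by (simp_all add: J_def t_def d_def algebra_simps)
    have \<phi>: "polyphase (Suc (Suc j)) \<alpha> (\<lambda>n. poly p (real n))"
      using polyphase_poly [OF p] by (simp only: \<alpha>_def d_def)
    have "S \<le> C1 * real (q ^ L) * Q powr (- \<kappa>)"
    proof (cases "\<forall>b. 1 \<le> b \<longrightarrow> b \<le> q ^ (3 * Suc j * s) \<longrightarrow>
        norm (e (real b * \<alpha>) - 1) \<ge> 2 * real (q ^ s) ^ 3 / real (q ^ L)")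
      case True
      then have "S \<le> 5 * real (q ^ L) * Q powr (- \<kappa>)"
        unfolding S_def Q_def \<kappa>_def using \<phi> s4 by (intro minor_arc_bound) auto
      also have "\<dots> \<le> C1 * real (q ^ L) * Q powr (- \<kappa>)"
        using C by (intro mult_right_mono) (auto simp: C1_def)
      finally show ?thesis .
    next
      case False
      then obtain b where b: "1 \<le> b" "b \<le> q ^ (3 * Suc j * s)"
        and e_b: "norm (e (real b * \<alpha>) - 1) < 2 * Q ^ 3 / real (q ^ L)"
        unfolding Q_def by (auto simp: not_le)
      obtain A :: int where "\<bar>real b * \<alpha> - of_int A\<bar> \<le> norm (e (real b * \<alpha>) - 1)"
        by (rule int_near_if_e_near_1)
      with e_b have A: "\<bar>real (b * fact d) * coeff p d - of_int A\<bar> \<le> 2 * Q ^ 3 / real (q ^ L)"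
        by (simp add: \<alpha>_def mult.assoc)
      have "S \<le> real (q ^ L) * (2 * pi * (2 * Q ^ 3 / real (q ^ L)) * real (q ^ t) ^ d +
          real (b * fact d) * C * real (q ^ t) powr (- c))"
        unfolding S_def d_def using IH p A tL b
        by (intro major_arc_bound [where A = A]) (auto simp: d_def Suc_le_eq)
      also have "\<dots> \<le> real (q ^ L) * (4 * pi / Q + fact d * C / Q)"
      proof (intro mult_left_mono add_mono)
        have t_pow: "real (q ^ t) = Q ^ K"
          by (simp add: Q_def t_def mult.commute flip: power_mult)
        \<comment> \<open>The 4 in \<open>J\<close> is made of the \<open>Q^3\<close> in the
          approximation error and one \<open>Q\<close> to be saved.\<close>
        have "Q * (Q ^ 3 * real (q ^ t) ^ d) = Q ^ J"
          by (simp only: t_pow J_def power_add power_mult) (simp add: eval_nat_numeral)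
        then have "Q ^ 3 * real (q ^ t) ^ d / real (q ^ L) \<le> 1 / Q"
          using QJ Q1 q by (simp add: field_simps)
        from mult_left_mono [OF this, of "4 * pi"]
        show "2 * pi * (2 * Q ^ 3 / real (q ^ L)) * real (q ^ t) ^ d \<le> 4 * pi / Q"
          by (simp add: mult_ac)
        have "real b \<le> Q ^ (3 * Suc j)"
          using b(2) by (simp add: Q_def mult.commute flip: power_mult of_nat_power)
        then have "real b \<le> Q powr real (3 * Suc j)"
          using Q1 by (simp only: powr_realpow)
        moreover have "real (q ^ t) powr (- c) = Q powr (- (real K * c))"
          unfolding t_pow using Q1 by (simp add: powr_powr flip: powr_realpow)
        ultimately have "real b * real (q ^ t) powr (- c) \<le> Q powr real (3 * Suc j) * Q powr (- (real K * c))"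
          by (simp add: mult_right_mono)
        \<comment> \<open>The extra 1 in \<open>K\<close>, beyond the exponent of the denominator,
          provides the factor \<open>1 / Q\<close>.\<close>
        also have "\<dots> \<le> Q powr (- 1)"
          using Q1 Kc by (simp only: powr_add [symmetric]) (intro powr_mono; simp)
        also have "\<dots> = 1 / Q"
          using Q1 by (simp add: powr_minus_divide)
        finally have "real b * real (q ^ t) powr (- c) \<le> 1 / Q" .
        from mult_left_mono [OF this, of "fact d * C"] C
        show "real (b * fact d) * C * real (q ^ t) powr (- c) \<le> fact d * C / Q"
          by (simp add: mult_ac)
      qed simp
      also have "\<dots> = (4 * pi + fact d * C) * real (q ^ L) * Q powr (- 1)"
        using Q1 by (simp add: powr_minus_divide field_simps)
      also have "\<dots> \<le> C1 * real (q ^ L) * Q powr (- \<kappa>)"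
        using Q1 C \<kappa> by (intro mult_mono powr_mono) (auto simp: C1_def)
      finally show ?thesis .
    qed
    also have "\<dots> \<le> C1 * real (q ^ L) * (real q powr \<kappa> * real (q ^ L) powr (- (\<kappa> / real J)))"
    proof (intro mult_left_mono powr_minus_le_powr_minus)
      \<comment> \<open>Rounding in \<open>s = L div J\<close> loses less than \<open>J\<close> in
        the exponent, paid for by the factor \<open>q powr \<kappa>\<close>.\<close>
      have "L \<le> (s + 1) * J"
        using dividend_less_div_times [of J L] by (simp add: s_def J_def algebra_simps)
      then have "real q ^ L \<le> real q ^ ((s + 1) * J)"
        using q by (intro power_increasing) auto
      also have "\<dots> = (real q * Q) ^ J"
        by (simp only: power_mult) (simp add: Q_def)
      finally show "real (q ^ L) \<le> (real q * Q) ^ J" by simp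
    qed (use q Q1 \<kappa> C q_power_ge_1 [of L] in \<open>auto simp: C1_def J_def simp flip: of_nat_power\<close>)
    finally show ?thesis
      by (simp add: S_def mult_ac)
  qed
  then have "power_saving d (\<kappa> / real J) (C1 * real q powr \<kappa>)"
    by (simp add: power_saving_def)
  moreover have "J > 0"
    by (simp add: J_def)
  then have "\<kappa> / real J > 0"
    using \<kappa> by simp
  ultimately show ?thesis
    unfolding d_def by blast
qed

section \<open>From lengths \<open>q^L\<close> to all lengths\<close>

text \<open>Cut into blocks of length \<open>Q = q^t\<close> near the square root of
  \<open>N\<close>: each block saves a power of \<open>Q\<close>, and the leftover is shorter than
  \<open>Q <= N / Q\<close>. In terms of \<open>N\<close> the exponent is halved.\<close>

lemma power_saving_all_lengths:
  assumes IH: "power_saving d c C" and c: "c > 0"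
  shows "\<exists>c'>0. \<exists>C'. \<forall>N\<ge>1. \<forall>p. degree p \<le> d \<longrightarrow>
    norm (\<Sum>n<N. f n * e (poly p (real n))) \<le> C' * real N * real N powr (- c')"
proof -
  \<comment> \<open>Capping at 1 lets the leftover, which saves only one factor \<open>Q\<close>,
    meet the same bound.\<close>
  define \<kappa> where "\<kappa> = min c 1"
  have C: "0 \<le> C"
    using IH by (rule power_saving_nonneg)
  have \<kappa>: "0 < \<kappa>" "\<kappa> \<le> c" "\<kappa> \<le> 1"
    using c by (auto simp: \<kappa>_def)
  have "norm (\<Sum>n<N. f n * e (poly p (real n))) \<le>
      (C + 1) * real q powr \<kappa> * real N * real N powr (- (\<kappa> / real 2))"
    if N: "N \<ge> 1" and p: "degree p \<le> d" for N p
  proof -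
    obtain t where t: "(q\<^sup>2) ^ t \<le> N" "N < (q\<^sup>2) ^ (t + 1)"
      using ex_power_ivl1 [of "q\<^sup>2" N] N q power_mono [OF q, of 2] by auto
    define Q where "Q = q ^ t"
    have Q1: "1 \<le> Q"
      using q_power_ge_1 by (simp add: Q_def)
    have "(q * Q)\<^sup>2 = (q\<^sup>2) ^ (t + 1)"
      by (simp add: Q_def power2_eq_square power_mult_distrib mult_ac)
    with t(2) have NQ: "N \<le> (q * Q)\<^sup>2"
      by linarith
    have QN: "Q * Q \<le> N"
      using t(1) by (simp add: Q_def power2_eq_square power_mult_distrib)
    define F where "F n = f n * e (poly p (real n))" for n
    have "norm (\<Sum>n<Q * (N div Q). F n) \<le> real (N div Q) * (C * real Q * real Q powr (- c))"
      unfolding Q_def F_def using p IH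
      by (intro norm_sum_blocks_le) (auto simp: power_saving_def simp del: of_nat_power)
    also have "\<dots> = real (Q * (N div Q)) * (C * real Q powr (- c))"
      by simp
    also have "\<dots> \<le> real N * (C * real Q powr (- \<kappa>))"
      using C Q1 \<kappa> by (intro mult_mono powr_mono of_nat_mono) auto
    finally have blocks: "norm (\<Sum>n<Q * (N div Q). F n) \<le> real N * (C * real Q powr (- \<kappa>))" .
    have "norm (\<Sum>r<N mod Q. F (Q * (N div Q) + r)) \<le> (\<Sum>r<N mod Q. 1)"
      by (intro sum_norm_le) (simp add: F_def norm_mult)
    also have "\<dots> \<le> real Q"
      using Q1 by simp
    also have "\<dots> \<le> real N * real Q powr (- 1)"
      using Q1 of_nat_mono [OF QN, where 'a = real] by (simp add: powr_minus_divide field_simps)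
    also have "\<dots> \<le> real N * real Q powr (- \<kappa>)"
      using Q1 \<kappa> by (intro mult_left_mono powr_mono) auto
    finally have rest: "norm (\<Sum>r<N mod Q. F (Q * (N div Q) + r)) \<le> real N * real Q powr (- \<kappa>)" .
    have "(\<Sum>n<N. F n) = (\<Sum>n<Q * (N div Q). F n) + (\<Sum>r<N mod Q. F (Q * (N div Q) + r))"
      using sum_lessThan_add [of F "Q * (N div Q)" "N mod Q"] by simp
    then have "norm (\<Sum>n<N. F n) \<le> real N * (C * real Q powr (- \<kappa>)) + real N * real Q powr (- \<kappa>)"
      using norm_triangle_mono [OF blocks rest] by simp
    also have "\<dots> = (C + 1) * real N * real Q powr (- \<kappa>)"
      by (simp add: algebra_simps)
    also have "\<dots> \<le> (C + 1) * real N * (real q powr \<kappa> * real N powr (- (\<kappa> / real 2)))"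
    proof (intro mult_left_mono powr_minus_le_powr_minus)
      show "real N \<le> (real q * real Q)\<^sup>2"
        using of_nat_mono [OF NQ, where 'a = real] by simp
    qed (use q Q1 \<kappa> C N in auto)
    finally show ?thesis
      by (simp add: F_def mult_ac)
  qed
  then show ?thesis
    using \<kappa> by (intro exI [of _ "\<kappa> / real 2"] exI [of _ "(C + 1) * real q powr \<kappa>"] conjI) auto
qed

text \<open>The constant term gives a unimodular factor; the linear coefficient is the frequency in
  the Gelfond condition.\<close>

lemma power_saving_1:
  assumes "gelfond_type f"
  shows "\<exists>c>0. \<exists>C. power_saving 1 c C"
proof -
  obtain c C where c: "c > 0" and C: "\<And>N \<alpha>. N \<ge> 1 \<Longrightarrow>
      norm ((1 / of_nat N) * (\<Sum>n<N. f n * e (real n * \<alpha>))) \<le> C * real N powr (- c)"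
    using assms unfolding gelfond_type_def by blast
  have "norm (\<Sum>n<q ^ L. f n * e (poly p (real n))) \<le> C * real (q ^ L) * real (q ^ L) powr (- c)"
    if p: "degree p \<le> 1" for L p
  proof -
    have "poly p x = coeff p 0 + x * coeff p 1" for x
    proof -
      consider "degree p = 0" | "degree p = 1"
        using p by linarith
      then show ?thesis
      proof cases
        case 1
        then obtain a where "p = [:a:]" by (rule degree_eq_zeroE)
        then show ?thesis by simp
      next
        case 2
        then obtain a b where "p = [:a, b:]" by (rule degree1_coeffs)
        then show ?thesis by simp
      qed
    qed
    then have "(\<Sum>n<q ^ L. f n * e (poly p (real n))) =
        e (coeff p 0) * (\<Sum>n<q ^ L. f n * e (real n * coeff p 1))"
      by (simp add: e_add sum_distrib_left mult_ac)
    then show ?thesis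
      using C [of "q ^ L" "coeff p 1"] q_power_ge_1 [of L] q
      by (simp add: norm_mult norm_divide norm_power field_simps)
  qed
  then show ?thesis
    using c unfolding power_saving_def by blast
qed

end

theorem theoremA:
  fixes q :: nat and f :: "nat \<Rightarrow> complex"
  assumes "q \<ge> 2"
    and "unimodular_seq f"
    and "q_multiplicative q f"
    and "gelfond_type f"
  shows "\<forall>d::nat. d \<ge> 1 \<longrightarrow>
    (\<exists>cd>0. \<exists>C. \<forall>N\<ge>1. \<forall>p::real poly. degree p \<le> d \<longrightarrow>
       norm ((1 / of_nat N) * (\<Sum>n<N. f n * e (poly p (real n)))) \<le> C * real N powr (- cd))"
proof (intro allI impI)
  fix d :: nat assume d: "d \<ge> 1"
  interpret unimodular_q_multiplicative q f
    using assms by unfold_locales (auto simp: unimodular_seq_def q_multiplicative_def)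
  have "\<exists>c>0. \<exists>C. power_saving d c C"
    using d
  proof (induction d rule: dec_induct)
    case base
    show ?case using assms(4) by (rule power_saving_1)
  next
    case (step d)
    then obtain j where "d = Suc j" by (cases d) auto
    with step.IH show ?case using power_saving_Suc by blast
  qed
  then obtain c C where "0 < c" "\<And>N p. N \<ge> 1 \<Longrightarrow> degree p \<le> d \<Longrightarrow>
      norm (\<Sum>n<N. f n * e (poly p (real n))) \<le> C * real N * real N powr (- c)"
    using power_saving_all_lengths by metis
  then show "\<exists>cd>0. \<exists>C. \<forall>N\<ge>1. \<forall>p::real poly. degree p \<le> d \<longrightarrow>
      norm ((1 / of_nat N) * (\<Sum>n<N. f n * e (poly p (real n)))) \<le> C * real N powr (- cd)"
    by (intro exI [of _ c] exI [of _ C] conjI)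
       (auto simp: norm_mult norm_divide pos_divide_le_eq mult_ac)
qed

end
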